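(* There exists $p_0>0$ such that for every $p\in(0,p_0)$ and every $\lambda>0$ $$\lim_{N\to+\infty}\frac{\#\mathcal B^\lambda_p(N)}{\#\mathcal C_p(N)}=0,$$ where $\mathcal C_p(N)$ is the set of $N$-periodic spin systems with $\lfloor 2pN^2\rfloor$ antiferromagnetic bonds per period cell, and $\mathcal B^\lambda_p(N)$ is the set of those spin systems in $\mathcal C_p(N)$ for which there exists a separating path of length $k\ge\lambda N$ contained in $[0,N]^2$.
   Context: Let $\mathcal N=\{\{i,j\}: i,j\in\mathbb Z^2,\ \|i-j\|=1\}$. A spin system is a function $c(\{i,j\})=c_{ij}\in\{-1,+1\}$ on $\mathcal N$; bonds with $c_{ij}=-1$ are called antiferromagnetic. For $N\in\mathbb N$ it is $N$-periodic if $c(\{i,j\})=c(\{i+(N,0),j+(N,0)\})=c(\{i+(0,N),j+(0,N)\})$ for all $\{i,j\}\in\mathcal N$. An $N$-periodic system is determined by its values on the $2N^2$ bonds of a period cell, i.e. the bonds $\{i,i+e_1\},\{i,i+e_2\}$ with $i\in\{0,\dots,N-1\}^2$, where $e_1=(1,0)$ and $e_2=(0,1)$. For $p\in(0,1)$, $\mathcal C_p(N)$ is the set of $N$-periodic spin systems with exactly $\lfloor 2pN^2\rfloor$ antiferromagnetic bonds among these $2N^2$ bonds, so that $\#\mathcal C_p(N)=\binom{2N^2}{\lfloor 2pN^2\rfloor}$. A path of length $k$ is a sequence $\gamma=(i_0,\dots,i_k)$ in $\mathbb Z^2$ with $\{i_s,i_{s+1}\}\in\mathcal N$ for all $s=0,\dots,k-1$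 and with the segments $[i_s,i_{s+1}]$ and $[i_t,i_{t+1}]$ different for $s\ne t$. For each $s$, the set $(i_s+[0,1]^2)\cap(i_{s+1}+[0,1]^2)$ is a segment with endpoints $\{\alpha_s,\beta_s\}\in\mathcal N$; set $\mu(\gamma)=\#\{s\in\{0,\dots,k-1\}: c_{\alpha_s\beta_s}=-1\}$. The path $\gamma$ is separating for $\{c_{ij}\}$ if $\mu(\gamma)>k/2$. It is contained in $[0,N]^2$ if $i_s\in[0,N]^2$ for each $s$. *)

theory Defs
  imports "HOL-Analysis.Analysis"
begin

type_synonym point = "int \<times> int"
type_synonym bond = "point set"

definition pt :: "point \<Rightarrow> real \<times> real" where
  "pt i = (real_of_int (fst i), real_of_int (snd i))"

text \<open>The norm on \<open>real \<times> real\<close> is the Euclidean one.\<close>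

definition bonds :: "bond set" where
  "bonds = {{i, j} | i j. norm (pt i - pt j) = 1}"

text \<open>Spin systems are extensional functions (\<open>undefined\<close> off \<open>bonds\<close>), so that
  counting them counts functions on \<open>bonds\<close>.\<close>

definition spin_systems :: "(bond \<Rightarrow> int) set" where
  "spin_systems = bonds \<rightarrow>\<^sub>E {-1, 1}"

definition periodic :: "nat \<Rightarrow> (bond \<Rightarrow> int) \<Rightarrow> bool" where
  "periodic N c \<longleftrightarrow>
     (\<forall>b\<in>bonds. c b = c ((\<lambda>i. i + (int N, 0)) ` b) \<and> c b = c ((\<lambda>i. i + (0, int N)) ` b))"

definition period_cell :: "nat \<Rightarrow> bond set" where
  "period_cell N =
     {{i, i + e} | i e. i \<in> {0..<int N} \<times> {0..<int N} \<and> e \<in> {(1, 0), (0, 1)}}"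

definition C_set :: "real \<Rightarrow> nat \<Rightarrow> (bond \<Rightarrow> int) set" where
  "C_set p N = {c \<in> spin_systems. periodic N c \<and>
     int (card {b \<in> period_cell N. c b = -1}) = \<lfloor>2 * p * (real N)\<^sup>2\<rfloor>}"

text \<open>A path \<open>(i\<^sub>0, \<dots>, i\<^sub>k)\<close> is the list of its \<open>k + 1\<close> points.\<close>

definition path_length :: "point list \<Rightarrow> nat" where
  "path_length \<gamma> = length \<gamma> - 1"

definition lattice_path :: "point list \<Rightarrow> bool" where
  "lattice_path \<gamma> \<longleftrightarrow> \<gamma> \<noteq> [] \<and>
     (\<forall>s < path_length \<gamma>. {\<gamma> ! s, \<gamma> ! Suc s} \<in> bonds) \<and>
     (\<forall>s < path_length \<gamma>. \<forall>t < path_length \<gamma>. s \<noteq> t \<longrightarrow>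
        closed_segment (pt (\<gamma> ! s)) (pt (\<gamma> ! Suc s)) \<noteq>
        closed_segment (pt (\<gamma> ! t)) (pt (\<gamma> ! Suc t)))"

definition unit_cell :: "point \<Rightarrow> (real \<times> real) set" where
  "unit_cell i = (+) (pt i) ` ({0..1} \<times> {0..1})"

text \<open>The bond \<open>{\<alpha>, \<beta>}\<close> formed by the endpoints of the common side of two adjacent
  cells; it exists and is unique by \<open>ex1_dual_bond\<close> below.\<close>

definition is_dual_bond :: "point \<Rightarrow> point \<Rightarrow> bond \<Rightarrow> bool" where
  "is_dual_bond i j b \<longleftrightarrow> b \<in> bonds \<and>
     (\<exists>\<alpha> \<beta>. b = {\<alpha>, \<beta>} \<and> unit_cell i \<inter> unit_cell j = closed_segment (pt \<alpha>) (pt \<beta>))"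

definition dual_bond :: "point \<Rightarrow> point \<Rightarrow> bond" where
  "dual_bond i j = (THE b. is_dual_bond i j b)"

definition \<mu> :: "(bond \<Rightarrow> int) \<Rightarrow> point list \<Rightarrow> nat" where
  "\<mu> c \<gamma> = card {s. s < path_length \<gamma> \<and> c (dual_bond (\<gamma> ! s) (\<gamma> ! Suc s)) = -1}"

definition separating :: "(bond \<Rightarrow> int) \<Rightarrow> point list \<Rightarrow> bool" where
  "separating c \<gamma> \<longleftrightarrow> lattice_path \<gamma> \<and> real (\<mu> c \<gamma>) > real (path_length \<gamma>) / 2"

definition contained_in_square :: "nat \<Rightarrow> point list \<Rightarrow> bool" where
  "contained_in_square N \<gamma> \<longleftrightarrow> set \<gamma> \<subseteq> {0..int N} \<times> {0..int N}"

definition B_set :: "real \<Rightarrow> real \<Rightarrow> nat \<Rightarrow> (bond \<Rightarrow> int) set" where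
  "B_set lam p N = {c \<in> C_set p N.
     \<exists>\<gamma>. separating c \<gamma> \<and> real (path_length \<gamma>) \<ge> lam * real N \<and> contained_in_square N \<gamma>}"

lemma inj_pt: "pt i = pt j \<longleftrightarrow> i = j"
  by (auto simp: pt_def prod_eq_iff)

lemma bonds_iff: "{i, j} \<in> bonds \<longleftrightarrow> norm (pt i - pt j) = 1"
proof
  assume "{i, j} \<in> bonds"
  then obtain i' j' where "{i, j} = {i', j'}" "norm (pt i' - pt j') = 1"
    unfolding bonds_def by blast
  then show "norm (pt i - pt j) = 1"
    by (metis doubleton_eq_iff norm_minus_commute)
next
  assume "norm (pt i - pt j) = 1"
  then show "{i, j} \<in> bonds" unfolding bonds_def by blast
qed

lemma norm_pt_diff_eq_1:
  "norm (pt i - pt j) = 1 \<longleftrightarrow> j - i \<in> {(1, 0), (-1, 0), (0, 1), (0, -1)}"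
proof -
  obtain a b c d where ij: "i = (a, b)" "j = (c, d)" by (cases i, cases j)
  have "norm (pt i - pt j) = 1 \<longleftrightarrow> (real_of_int a - real_of_int c)\<^sup>2 + (real_of_int b - real_of_int d)\<^sup>2 = 1"
    by (simp add: ij pt_def norm_Pair)
  also have "\<dots> \<longleftrightarrow> real_of_int ((c - a)\<^sup>2 + (d - b)\<^sup>2) = real_of_int 1"
    by (simp add: power2_commute)
  also have "\<dots> \<longleftrightarrow> (c - a)\<^sup>2 + (d - b)\<^sup>2 = 1"
    by (simp only: of_int_eq_iff)
  also have "\<dots> \<longleftrightarrow> (c - a, d - b) \<in> {(1, 0), (-1, 0), (0, 1), (0, -1)}"
  proof
    assume *: "(c - a)\<^sup>2 + (d - b)\<^sup>2 = 1"
    have sq: "\<bar>x\<bar> \<le> 1" if "x\<^sup>2 \<le> 1" for x :: int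
      using that by (simp add: abs_square_le_1)
    have "\<bar>c - a\<bar> \<le> 1" "\<bar>d - b\<bar> \<le> 1"
      using * zero_le_power2[of "c - a"] zero_le_power2[of "d - b"]
      by (intro sq; linarith)+
    then have "c - a \<in> {-1, 0, 1}" "d - b \<in> {-1, 0, 1}" by auto
    then show "(c - a, d - b) \<in> {(1, 0), (-1, 0), (0, 1), (0, -1)}" using * by auto
  qed auto
  finally show ?thesis by (simp add: ij)
qed

lemma unit_cell_eq:
  "unit_cell i = {real_of_int (fst i)..real_of_int (fst i) + 1} \<times>
                 {real_of_int (snd i)..real_of_int (snd i) + 1}"
proof -
  have "z \<in> unit_cell i"
    if "z \<in> {real_of_int (fst i)..real_of_int (fst i) + 1} \<times>
            {real_of_int (snd i)..real_of_int (snd i) + 1}" for z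
    unfolding unit_cell_def
    by (rule image_eqI[where x = "z - pt i"]) (use that in \<open>auto simp: pt_def\<close>)
  then show ?thesis by (auto simp: unit_cell_def pt_def)
qed

lemma is_dual_bond_unique:
  assumes "is_dual_bond i j b" "is_dual_bond i j b'"
  shows "b = b'"
proof -
  obtain x y x' y' where *: "b = {x, y}" "b' = {x', y'}"
    "closed_segment (pt x) (pt y) = closed_segment (pt x') (pt y')"
    using assms unfolding is_dual_bond_def by auto
  then have "{pt x, pt y} = {pt x', pt y'}" by (simp add: closed_segment_eq)
  then show ?thesis by (auto simp: * doubleton_eq_iff inj_pt)
qed

lemma is_dual_bond_commute: "is_dual_bond i j b \<longleftrightarrow> is_dual_bond j i b"
  by (simp add: is_dual_bond_def Int_commute)

lemma is_dual_bond_right: "is_dual_bond i (i + (1, 0)) {i + (1, 0), i + (1, 1)}"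
proof -
  obtain a b where i: "i = (a, b)" by (cases i)
  have "closed_segment (pt (i + (1, 0))) (pt (i + (1, 1))) =
        {real_of_int a + 1} \<times> {real_of_int b..real_of_int b + 1}"
  proof (intro equalityI subsetI)
    fix z assume "z \<in> closed_segment (pt (i + (1, 0))) (pt (i + (1, 1)))"
    then show "z \<in> {real_of_int a + 1} \<times> {real_of_int b..real_of_int b + 1}"
      by (auto simp: closed_segment_def pt_def i algebra_simps)
  next
    fix z assume "z \<in> {real_of_int a + 1} \<times> {real_of_int b..real_of_int b + 1}"
    then show "z \<in> closed_segment (pt (i + (1, 0))) (pt (i + (1, 1)))"
      by (auto simp: closed_segment_def pt_def i algebra_simps
               intro!: exI[where x = "snd z - real_of_int b"])
  qed
  moreover have "unit_cell i \<inter> unit_cell (i + (1, 0)) =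
        {real_of_int a + 1} \<times> {real_of_int b..real_of_int b + 1}"
    by (auto simp: unit_cell_eq i)
  moreover have "{i + (1, 0), i + (1, 1)} \<in> bonds"
    by (simp add: bonds_iff norm_pt_diff_eq_1)
  ultimately show ?thesis unfolding is_dual_bond_def by blast
qed

lemma is_dual_bond_up: "is_dual_bond i (i + (0, 1)) {i + (0, 1), i + (1, 1)}"
proof -
  obtain a b where i: "i = (a, b)" by (cases i)
  have "closed_segment (pt (i + (0, 1))) (pt (i + (1, 1))) =
        {real_of_int a..real_of_int a + 1} \<times> {real_of_int b + 1}"
  proof (intro equalityI subsetI)
    fix z assume "z \<in> closed_segment (pt (i + (0, 1))) (pt (i + (1, 1)))"
    then show "z \<in> {real_of_int a..real_of_int a + 1} \<times> {real_of_int b + 1}"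
      by (auto simp: closed_segment_def pt_def i algebra_simps)
  next
    fix z assume "z \<in> {real_of_int a..real_of_int a + 1} \<times> {real_of_int b + 1}"
    then show "z \<in> closed_segment (pt (i + (0, 1))) (pt (i + (1, 1)))"
      by (auto simp: closed_segment_def pt_def i algebra_simps
               intro!: exI[where x = "fst z - real_of_int a"])
  qed
  moreover have "unit_cell i \<inter> unit_cell (i + (0, 1)) =
        {real_of_int a..real_of_int a + 1} \<times> {real_of_int b + 1}"
    by (auto simp: unit_cell_eq i)
  moreover have "{i + (0, 1), i + (1, 1)} \<in> bonds"
    by (simp add: bonds_iff norm_pt_diff_eq_1)
  ultimately show ?thesis unfolding is_dual_bond_def by blast
qed

lemma ex1_dual_bond:
  assumes "{i, j} \<in> bonds"
  shows "\<exists>!b. is_dual_bond i j b"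
proof -
  have "j - i \<in> {(1, 0), (-1, 0), (0, 1), (0, -1)}"
    using assms by (simp add: bonds_iff norm_pt_diff_eq_1)
  then have "j = i + (1, 0) \<or> i = j + (1, 0) \<or> j = i + (0, 1) \<or> i = j + (0, 1)"
    by (cases i; cases j) auto
  then have "\<exists>b. is_dual_bond i j b"
    using is_dual_bond_right is_dual_bond_up is_dual_bond_commute by metis
  then show ?thesis using is_dual_bond_unique by blast
qed

lemma dual_bond_commute: "dual_bond i j = dual_bond j i"
  by (simp add: dual_bond_def is_dual_bond_commute)

lemma dual_bond_right: "dual_bond i (i + (1, 0)) = {i + (1, 0), i + (1, 1)}"
  unfolding dual_bond_def
  by (rule the_equality, rule is_dual_bond_right) (rule is_dual_bond_unique[OF _ is_dual_bond_right])

lemma dual_bond_up: "dual_bond i (i + (0, 1)) = {i + (0, 1), i + (1, 1)}"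
  unfolding dual_bond_def
  by (rule the_equality, rule is_dual_bond_up) (rule is_dual_bond_unique[OF _ is_dual_bond_up])

end

theory Submission
  imports Defs "HOL-Real_Asymp.Real_Asymp"
begin

text \<open>A Peierls union bound. A separating path of length \<open>k\<close> in \<open>[0, N]\<^sup>2\<close> crosses more than \<open>k / 2\<close>
  distinct antiferromagnetic bonds. At most four bonds of the square are congruent modulo \<open>N\<close>, so
  these cover at least \<open>k / 8\<close> bonds of the period cell, and a given set of \<open>m\<close> cell bonds is
  antiferromagnetic for a proportion at most \<open>p ^ m\<close> of \<open>C_set p N\<close>. With at most
  \<open>(N + 1)\<^sup>2 * 4 ^ k\<close> walks and \<open>2 ^ k\<close> choices of antiferromagnetic steps, and \<open>p = q ^ 8\<close>, each \<open>k\<close>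
  contributes at most \<open>(N + 1)\<^sup>2 * (8 * q) ^ k\<close>. Only polynomially many \<open>k\<close> occur, all at least
  \<open>lam * N\<close>, so \<open>q \<le> 1 / 16\<close> is enough.\<close>

section \<open>Normal form of bonds, and the period cell\<close>

definition units :: "point set" where
  "units = {(1, 0), (0, 1)}"

text \<open>For a direction in \<open>units\<close> the base point is the left or lower endpoint.
  Every bond arises this way (\<open>bondsE\<close>) from exactly one pair
  (\<open>edge_eq_iff\<close>), so unordered bonds can be handled as pairs of a base point and a
  direction.\<close>

definition edge :: "point \<Rightarrow> point \<Rightarrow> bond" where
  "edge i e = {i, i + e}"

lemma finite_units: "finite units" and card_units: "card units = 2"
  by (auto simp: units_def)

lemma edge_eq_iff:
  assumes "e \<in> units" "f \<in> units"
  shows "edge i e = edge j f \<longleftrightarrow> i = j \<and> e = f"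
  using assms by (auto simp: edge_def units_def doubleton_eq_iff prod_eq_iff)

lemma edge_in_bonds: "e \<in> units \<Longrightarrow> edge i e \<in> bonds"
  by (auto simp: edge_def units_def bonds_iff norm_pt_diff_eq_1)

lemma bondsE:
  assumes "b \<in> bonds"
  obtains i e where "e \<in> units" "b = edge i e"
proof -
  obtain i j where b: "b = {i, j}" and "norm (pt i - pt j) = 1"
    using assms by (auto simp: bonds_def)
  then have "j - i \<in> {(1, 0), (-1, 0), (0, 1), (0, -1)}"
    by (simp add: norm_pt_diff_eq_1)
  then have "j - i \<in> units \<or> i - j \<in> units"
    by (cases i; cases j) (auto simp: units_def)
  moreover have "b = edge i (j - i)" "b = edge j (i - j)"
    by (auto simp: b edge_def)
  ultimately show ?thesis using that by blast
qed

lemma translate_edge: "(\<lambda>i. i + v) ` edge i e = edge (i + v) e"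
  by (auto simp: edge_def algebra_simps)

lemma Collect_eq_case_prod_image:
  "{f x y | x y. x \<in> A \<and> y \<in> B} = (\<lambda>(x, y). f x y) ` (A \<times> B)"
  by auto

lemma period_cell_eq:
  "period_cell N = (\<lambda>(i, e). edge i e) ` (({0..<int N} \<times> {0..<int N}) \<times> units)"
  unfolding period_cell_def by (fold edge_def units_def) (rule Collect_eq_case_prod_image)

lemma finite_period_cell: "finite (period_cell N)"
  by (simp add: period_cell_eq finite_units)

lemma card_period_cell: "card (period_cell N) = 2 * N\<^sup>2"
proof -
  have "inj_on (\<lambda>(i, e). edge i e) (({0..<int N} \<times> {0..<int N}) \<times> units)"
    by (auto simp: inj_on_def edge_eq_iff)
  then show ?thesis
    by (simp add: period_cell_eq card_image card_units card_cartesian_product power2_eq_square)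
qed

lemma period_cell_subset_bonds: "period_cell N \<subseteq> bonds"
  by (auto simp: period_cell_eq edge_in_bonds)

section \<open>Reduction of bonds modulo \<open>N\<close>\<close>

definition mod_point :: "nat \<Rightarrow> point \<Rightarrow> point" where
  "mod_point N i = (fst i mod int N, snd i mod int N)"

text \<open>The representative in the period cell of a bond modulo \<open>N\<close> (for
  \<open>N > 0\<close>). Reducing both endpoints separately could tear a bond apart at the boundary
  of the cell, so only the base point is reduced and the direction is kept.\<close>

definition wrap :: "nat \<Rightarrow> bond \<Rightarrow> bond" where
  "wrap N b = (THE b'. \<exists>i. \<exists>e\<in>units. b = edge i e \<and> b' = edge (mod_point N i) e)"

lemma wrap_edge:
  assumes "e \<in> units"
  shows "wrap N (edge i e) = edge (mod_point N i) e"
  unfolding wrap_def using assms by (auto simp: edge_eq_iff intro!: the_equality)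

lemma wrap_in_period_cell:
  assumes "N > 0" "b \<in> bonds"
  shows "wrap N b \<in> period_cell N"
  using assms(2)
proof (rule bondsE)
  fix i e assume "e \<in> units" "b = edge i e"
  moreover have "mod_point N i \<in> {0..<int N} \<times> {0..<int N}"
    using assms(1) by (simp add: mod_point_def)
  ultimately show ?thesis
    unfolding period_cell_eq by (intro image_eqI[where x = "(mod_point N i, e)"]) (simp_all add: wrap_edge)
qed

lemma wrap_period_cell:
  assumes "b \<in> period_cell N"
  shows "wrap N b = b"
  using assms by (auto simp: period_cell_eq wrap_edge mod_point_def)

lemma int_periodic_mod:
  fixes f :: "int \<Rightarrow> 'a"
  assumes "\<And>x. f (x + m) = f x"
  shows "f (x mod m) = f x"
proof -
  have "f (y + a * m) = f y" for a y
  proof (induction a rule: int_induct[where k = 0])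
    case (step1 a)
    then show ?case using assms[of "y + a * m"] by (simp add: algebra_simps)
  next
    case (step2 a)
    then show ?case using assms[of "y + (a - 1) * m"] by (simp add: algebra_simps)
  qed simp
  from this[of "x mod m" "x div m"] show ?thesis by simp
qed

text \<open>Periodicity gives invariance under a shift by \<open>N\<close> in each coordinate
  separately, so the two coordinates of the base point are reduced one after the other.\<close>

lemma periodic_wrap:
  assumes "periodic N c" "b \<in> bonds"
  shows "c (wrap N b) = c b"
  using assms(2)
proof (rule bondsE)
  fix i e assume e: "e \<in> units" and b: "b = edge i e"
  have shift: "c (edge (i + (int N, 0)) e) = c (edge i e)"
    "c (edge (i + (0, int N)) e) = c (edge i e)" for i
    using assms(1) edge_in_bonds[OF e, of i] by (auto simp: periodic_def translate_edge)
  have "c (edge (x mod int N, y) e) = c (edge (x, y) e)" for x y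
    using shift(1)[of "(_, y)"] by (intro int_periodic_mod[of "\<lambda>x. c (edge (x, y) e)"]) simp
  moreover have "c (edge (x, y mod int N) e) = c (edge (x, y) e)" for x y
    using shift(2)[of "(x, _)"] by (intro int_periodic_mod[of "\<lambda>y. c (edge (x, y) e)"]) simp
  ultimately show ?thesis
    by (cases i) (simp add: b wrap_edge e mod_point_def)
qed

section \<open>Periodic systems as subsets of the period cell\<close>

definition antiferro :: "nat \<Rightarrow> (bond \<Rightarrow> int) \<Rightarrow> bond set" where
  "antiferro N c = {b \<in> period_cell N. c b = -1}"

lemma spin_systemsD: "c \<in> spin_systems \<Longrightarrow> b \<in> bonds \<Longrightarrow> c b = -1 \<or> c b = 1"
  by (auto simp: spin_systems_def dest: PiE_mem)

text \<open>By \<open>periodic_wrap\<close> a periodic system is determined by its values on the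
  cell, hence by where it equals -1 there; conversely every subset of the cell of the right size
  extends periodically. Counting systems thus becomes counting subsets of fixed size.\<close>

lemma bij_betw_antiferro:
  assumes "N > 0" "p \<ge> 0"
  shows "bij_betw (antiferro N) (C_set p N)
           {S. S \<subseteq> period_cell N \<and> card S = nat \<lfloor>2 * p * (real N)\<^sup>2\<rfloor>}"
  unfolding bij_betw_def
proof
  show "inj_on (antiferro N) (C_set p N)"
  proof (rule inj_onI)
    fix c d assume c: "c \<in> C_set p N" and d: "d \<in> C_set p N" and eq: "antiferro N c = antiferro N d"
    have "c b = d b" for b
    proof (cases "b \<in> bonds")
      case True
      have w: "wrap N b \<in> period_cell N" using wrap_in_period_cell assms(1) True .
      then have "c (wrap N b) = -1 \<longleftrightarrow> d (wrap N b) = -1"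
        using eq by (auto simp: antiferro_def)
      then have "c b = -1 \<longleftrightarrow> d b = -1"
        using c d True by (simp add: C_set_def periodic_wrap)
      then show ?thesis
        using c d spin_systemsD[OF _ True, of c] spin_systemsD[OF _ True, of d]
        by (auto simp: C_set_def)
    next
      case False
      then show ?thesis using c d
        by (simp add: C_set_def spin_systems_def PiE_iff extensional_def)
    qed
    then show "c = d" by blast
  qed
  show "antiferro N ` C_set p N =
      {S. S \<subseteq> period_cell N \<and> card S = nat \<lfloor>2 * p * (real N)\<^sup>2\<rfloor>}"
  proof (intro equalityI subsetI)
    fix S assume S: "S \<in> {S. S \<subseteq> period_cell N \<and> card S = nat \<lfloor>2 * p * (real N)\<^sup>2\<rfloor>}"
    \<comment> \<open>The periodic extension of \<open>S\<close>, left undefined off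
      \<open>bonds\<close> so that it is an extensional function.\<close>
    define c :: "bond \<Rightarrow> int" where "c = (\<lambda>b\<in>bonds. if wrap N b \<in> S then -1 else 1)"
    have af: "antiferro N c = S"
      using S period_cell_subset_bonds[of N]
      by (auto simp: antiferro_def c_def wrap_period_cell split: if_splits)
    have "periodic N c"
      unfolding periodic_def
    proof
      fix b assume "b \<in> bonds"
      then obtain i e where "e \<in> units" "b = edge i e" by (rule bondsE)
      then show "c b = c ((\<lambda>i. i + (int N, 0)) ` b) \<and> c b = c ((\<lambda>i. i + (0, int N)) ` b)"
        by (simp add: c_def translate_edge edge_in_bonds wrap_edge mod_point_def)
    qed
    moreover have "c \<in> spin_systems" by (auto simp: spin_systems_def c_def)
    \<comment> \<open>As \<open>p\<close> is nonnegative, so is the floor, and \<open>nat\<close>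
      leaves its value unchanged.\<close>
    ultimately have "c \<in> C_set p N"
      using S assms(2) af by (simp add: C_set_def antiferro_def)
    then show "S \<in> antiferro N ` C_set p N" using af by blast
  qed (auto simp: C_set_def antiferro_def)
qed

section \<open>The proportion of subsets of fixed size that contain a given set\<close>

lemma binomial_diff_le:
  assumes "m \<le> n" "n \<le> M"
  shows "real ((M - m) choose (n - m)) \<le> (real n / real M) ^ m * real (M choose n)"
  using assms
proof (induction m arbitrary: n M)
  case (Suc m)
  then obtain n' M' where nM: "n = Suc n'" "M = Suc M'" "m \<le> n'" "n' \<le> M'"
    by (metis Suc_le_D Suc_le_mono le_trans)
  \<comment> \<open>The quotient of the two binomials is the product of
    \<open>(n - i) / (M - i)\<close> over \<open>i < m\<close>, and each factor is at most
    \<open>n / M\<close> because \<open>n \<le> M\<close>. The induction hypothesis at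
    \<open>n'\<close> and \<open>M'\<close> leaves one factor, which the absorption identity
    supplies as exactly \<open>n / M\<close>.\<close>
  have "real ((M - Suc m) choose (n - Suc m)) \<le> (real n' / real M') ^ m * real (M' choose n')"
    using Suc.IH[of n' M'] nM by simp
  also have "\<dots> \<le> (real n / real M) ^ m * real (M' choose n')"
    using nM by (intro mult_right_mono power_mono) (auto simp: divide_simps algebra_simps)
  also have "real (M' choose n') = real n / real M * real (M choose n)"
    using Suc_times_binomial[of n' M'] unfolding nM
    by (simp add: field_simps flip: of_nat_mult del: of_nat_Suc binomial_Suc_Suc)
  finally show ?case by (simp add: mult_ac)
qed simp

text \<open>Deleting \<open>T\<close> turns the supersets of \<open>T\<close> into arbitrary subsets
  of \<open>P - T\<close> with \<open>card T\<close> fewer elements.\<close>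

lemma card_supersets:
  assumes "finite P" "T \<subseteq> P" "card T \<le> n"
  shows "card {S. S \<subseteq> P \<and> card S = n \<and> T \<subseteq> S} = (card P - card T) choose (n - card T)"
proof -
  have fT: "finite T" using assms finite_subset by blast
  have "bij_betw (\<lambda>S. S - T) {S. S \<subseteq> P \<and> card S = n \<and> T \<subseteq> S}
      {S. S \<subseteq> P - T \<and> card S = n - card T}"
  proof (rule bij_betwI[where g = "\<lambda>S. S \<union> T"])
    show "(\<lambda>S. S \<union> T) \<in> {S. S \<subseteq> P - T \<and> card S = n - card T} \<rightarrow>
        {S. S \<subseteq> P \<and> card S = n \<and> T \<subseteq> S}"
    proof
      fix S assume S: "S \<in> {S. S \<subseteq> P - T \<and> card S = n - card T}"
      then have "card (S \<union> T) = card S + card T"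
        using assms fT by (intro card_Un_disjoint) (auto intro: finite_subset)
      then show "S \<union> T \<in> {S. S \<subseteq> P \<and> card S = n \<and> T \<subseteq> S}" using S assms by auto
    qed
  qed (use fT in \<open>auto simp: card_Diff_subset\<close>)
  then show ?thesis
    using assms fT by (simp add: bij_betw_same_card n_subsets card_Diff_subset)
qed

lemma card_supersets_le:
  assumes "finite P" "T \<subseteq> P" "n \<le> card P"
  shows "real (card {S. S \<subseteq> P \<and> card S = n \<and> T \<subseteq> S})
           \<le> (real n / real (card P)) ^ card T * real (card P choose n)"
proof (cases "card T \<le> n")
  case True
  then show ?thesis using assms by (simp add: card_supersets binomial_diff_le)
next
  \<comment> \<open>Here \<open>n - card T\<close> would truncate to 0 and the binomial formula
    would fail, but no superset of \<open>T\<close> has only \<open>n\<close> elements.\<close>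
  case False
  then have "{S. S \<subseteq> P \<and> card S = n \<and> T \<subseteq> S} = {}"
    using assms card_mono finite_subset by blast
  then show ?thesis by (simp only: card.empty) simp
qed

lemma card_C_set_fixed_le:
  assumes "N > 0" "0 \<le> p" "p \<le> 1" "T \<subseteq> bonds" "finite T"
  shows "real (card {c \<in> C_set p N. \<forall>b\<in>T. c b = -1})
           \<le> p ^ card (wrap N ` T) * real (card (C_set p N))"
proof -
  let ?P = "period_cell N" and ?n = "nat \<lfloor>2 * p * (real N)\<^sup>2\<rfloor>"
  let ?W = "wrap N ` T"
  have W: "?W \<subseteq> ?P" using assms wrap_in_period_cell by blast
  note bij = bij_betw_antiferro[OF assms(1,2)]
  have card_C: "card (C_set p N) = card ?P choose ?n"
    using bij_betw_same_card[OF bij] by (simp add: n_subsets finite_period_cell)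
  have n_le: "real ?n \<le> p * real (card ?P)"
    using assms(2) by (simp add: card_period_cell mult_ac)
  also have "\<dots> \<le> 1 * real (card ?P)"
    using assms(3) by (intro mult_right_mono) auto
  finally have n_le': "?n \<le> card ?P" by simp
  have sub: "antiferro N ` {c \<in> C_set p N. \<forall>b\<in>T. c b = -1}
      \<subseteq> {S. S \<subseteq> ?P \<and> card S = ?n \<and> ?W \<subseteq> S}"
  proof
    fix S assume "S \<in> antiferro N ` {c \<in> C_set p N. \<forall>b\<in>T. c b = -1}"
    then obtain c where c: "c \<in> C_set p N" "\<forall>b\<in>T. c b = -1" "S = antiferro N c" by blast
    then have "?W \<subseteq> S"
      using W assms(4) periodic_wrap[of N c] by (auto simp: antiferro_def C_set_def subset_eq)
    moreover have "S \<in> {S. S \<subseteq> ?P \<and> card S = ?n}"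
      using bij_betw_imp_surj_on[OF bij] c by blast
    ultimately show "S \<in> {S. S \<subseteq> ?P \<and> card S = ?n \<and> ?W \<subseteq> S}" by blast
  qed
  have "inj_on (antiferro N) {c \<in> C_set p N. \<forall>b\<in>T. c b = -1}"
    using bij_betw_imp_inj_on[OF bij] by (rule inj_on_subset) blast
  then have "card {c \<in> C_set p N. \<forall>b\<in>T. c b = -1}
      \<le> card {S. S \<subseteq> ?P \<and> card S = ?n \<and> ?W \<subseteq> S}"
    using sub finite_period_cell by (intro card_inj_on_le) auto
  then have "real (card {c \<in> C_set p N. \<forall>b\<in>T. c b = -1})
      \<le> (real ?n / real (card ?P)) ^ card ?W * real (card ?P choose ?n)"
    using card_supersets_le[OF finite_period_cell W n_le'] by linarith
  also have "\<dots> \<le> p ^ card ?W * real (card ?P choose ?n)"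
    using n_le assms(1) by (intro mult_right_mono power_mono) (auto simp: card_period_cell divide_simps)
  finally show ?thesis by (simp add: card_C)
qed

section \<open>Bonds met by paths in the square: multiplicity modulo \<open>N\<close>, and dual
  bonds\<close>

definition square_bonds :: "nat \<Rightarrow> bond set" where
  "square_bonds N = (\<lambda>(i, e). edge i e) ` (({0..int N} \<times> {0..int N}) \<times> units)"

lemma finite_square_bonds: "finite (square_bonds N)"
  by (simp add: square_bonds_def finite_units)

lemma card_square_bonds_le: "card (square_bonds N) \<le> 2 * (N + 1)\<^sup>2"
proof -
  have "card (square_bonds N) \<le> card (({0..int N} \<times> {0..int N}) \<times> units)"
    unfolding square_bonds_def by (intro card_image_le) (simp add: finite_units)
  also have "\<dots> = 2 * (N + 1)\<^sup>2"
    by (simp add: card_cartesian_product card_units power2_eq_square nat_add_distrib)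
  finally show ?thesis .
qed

lemma mod_point_div_inj:
  assumes "mod_point N i = mod_point N j"
    and "fst i div int N = fst j div int N" "snd i div int N = snd j div int N"
  shows "i = j"
proof -
  have eq: "x = y" if "x mod m = y mod m" "x div m = y div m" for x y m :: int
    using that by (metis div_mult_mod_eq)
  have mods: "fst i mod int N = fst j mod int N" "snd i mod int N = snd j mod int N"
    using assms(1) by (simp_all add: mod_point_def)
  show ?thesis
    using eq[OF mods(1) assms(2)] eq[OF mods(2) assms(3)] by (rule prod_eqI)
qed

text \<open>A bond is recovered from its wrapped bond together with the quotients by
  \<open>N\<close> of the two base coordinates. Coordinates in \<open>{0..int N}\<close> have
  quotient 0 or 1, with 1 only at \<open>int N\<close>, so each fibre of \<open>wrap N\<close> has
  at most four elements.\<close>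

lemma card_le_card_wrap:
  assumes "N > 0" "T \<subseteq> square_bonds N"
  shows "card T \<le> 4 * card (wrap N ` T)"
proof -
  let ?U = "{(i, e). e \<in> units \<and> edge i e \<in> T}"
  let ?f = "\<lambda>(i, e). (wrap N (edge i e), fst i div int N, snd i div int N)"
  have fT: "finite T" using assms(2) finite_square_bonds finite_subset by blast
  have T: "T = (\<lambda>(i, e). edge i e) ` ?U"
    using assms(2) by (auto simp: square_bonds_def)
  have inj: "inj_on (\<lambda>(i, e). edge i e) ?U"
    by (auto simp: inj_on_def edge_eq_iff)
  have "inj_on ?f ?U"
  proof (rule inj_onI, clarify)
    fix i e j f
    assume units: "e \<in> units" "f \<in> units"
      and wrap: "wrap N (edge i e) = wrap N (edge j f)"
      and div: "fst i div int N = fst j div int N" "snd i div int N = snd j div int N"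
    have "mod_point N i = mod_point N j \<and> e = f"
      using wrap by (simp add: wrap_edge edge_eq_iff units)
    then show "i = j \<and> e = f" by (simp add: mod_point_div_inj[OF _ div])
  qed
  moreover have "?f ` ?U \<subseteq> wrap N ` T \<times> {0, 1} \<times> {0, 1}"
  proof (rule image_subsetI)
    fix u assume "u \<in> ?U"
    then obtain i e where u: "u = (i, e)" and e: "e \<in> units" and T: "edge i e \<in> T" by blast
    have "edge i e \<in> square_bonds N" using T assms(2) by blast
    then obtain j f where "edge i e = edge j f" "f \<in> units" and j: "j \<in> {0..int N} \<times> {0..int N}"
      by (auto simp: square_bonds_def)
    then have "i = j" using e by (simp add: edge_eq_iff)
    moreover have "x div int N \<in> {0, 1}" if "0 \<le> x" "x \<le> int N" for x
      using that assms(1) by (cases "x = int N") auto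
    ultimately have "fst i div int N \<in> {0, 1}" "snd i div int N \<in> {0, 1}"
      using j by (simp_all add: mem_Times_iff)
    then show "?f u \<in> wrap N ` T \<times> {0, 1} \<times> {0, 1}"
      using T by (auto simp: u)
  qed
  ultimately have "card ?U \<le> card (wrap N ` T \<times> {0, 1 :: int} \<times> {0, 1 :: int})"
    using fT by (intro card_inj_on_le) auto
  moreover have "card T = card ?U"
    using card_image[OF inj] unfolding T[symmetric] .
  ultimately show ?thesis by (simp add: card_cartesian_product)
qed

text \<open>Here \<open>k\<close> is the right or upper endpoint of the step and
  \<open>prod.swap e\<close> the direction of the step; the dual bond starts at \<open>k\<close> and
  runs perpendicular to it. This form lets the step be read off from its dual bond.\<close>

lemma dual_bondE:
  assumes "{i, j} \<in> bonds"
  obtains k e where "e \<in> units" "{i, j} = {k, k - prod.swap e}" "dual_bond i j = edge k e"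
proof -
  have right: "dual_bond i (i + (1, 0)) = edge (i + (1, 0)) (0, 1)"
    and up: "dual_bond i (i + (0, 1)) = edge (i + (0, 1)) (1, 0)" for i
    by (simp_all add: dual_bond_right dual_bond_up edge_def add.assoc)
  then have right': "dual_bond (i + (1, 0)) i = edge (i + (1, 0)) (0, 1)"
    and up': "dual_bond (i + (0, 1)) i = edge (i + (0, 1)) (1, 0)" for i
    by (metis dual_bond_commute)+
  have "j - i \<in> {(1, 0), (-1, 0), (0, 1), (0, -1)}"
    using assms by (simp add: bonds_iff norm_pt_diff_eq_1)
  then consider "j = i + (1, 0)" | "i = j + (1, 0)" | "j = i + (0, 1)" | "i = j + (0, 1)"
    by (cases i; cases j) auto
  then show ?thesis
  proof cases
    case 1
    show ?thesis
      by (rule that[of "(0, 1)" j]) (simp_all add: 1 units_def right insert_commute)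
  next
    case 2
    show ?thesis
      by (rule that[of "(0, 1)" i]) (simp_all add: 2 units_def right' insert_commute)
  next
    case 3
    show ?thesis
      by (rule that[of "(1, 0)" j]) (simp_all add: 3 units_def up insert_commute)
  next
    case 4
    show ?thesis
      by (rule that[of "(1, 0)" i]) (simp_all add: 4 units_def up' insert_commute)
  qed
qed

text \<open>The base point of the dual bond is an endpoint of the step, so it lies in the square.
  The other end may stick out beyond the right or upper side, which is why
  \<open>square_bonds\<close> constrains base points only.\<close>

lemma dual_bond_in_square_bonds:
  assumes "{i, j} \<in> bonds" "i \<in> {0..int N} \<times> {0..int N}" "j \<in> {0..int N} \<times> {0..int N}"
  shows "dual_bond i j \<in> square_bonds N"
  using assms(1)
proof (rule dual_bondE)
  fix k e
  assume e: "e \<in> units" and k: "{i, j} = {k, k - prod.swap e}" and d: "dual_bond i j = edge k e"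
  have "k = i \<or> k = j" using k by blast
  then have "k \<in> {0..int N} \<times> {0..int N}" using assms(2,3) by blast
  then show ?thesis
    unfolding square_bonds_def d by (intro image_eqI[where x = "(k, e)"]) (simp_all add: e)
qed

lemma dual_bond_inj:
  assumes "{i, j} \<in> bonds" "{i', j'} \<in> bonds" "dual_bond i j = dual_bond i' j'"
  shows "{i, j} = {i', j'}"
proof -
  obtain k e where "e \<in> units" "{i, j} = {k, k - prod.swap e}" "dual_bond i j = edge k e"
    using assms(1) by (rule dual_bondE)
  moreover obtain k' e' where "e' \<in> units" "{i', j'} = {k', k' - prod.swap e'}"
    "dual_bond i' j' = edge k' e'"
    using assms(2) by (rule dual_bondE)
  ultimately show ?thesis using assms(3) by (simp add: edge_eq_iff)
qed

section \<open>Counting walks\<close>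

definition walks :: "nat \<Rightarrow> nat \<Rightarrow> point list set" where
  "walks N k = {\<gamma>. length \<gamma> = Suc k \<and> contained_in_square N \<gamma> \<and>
     (\<forall>s<k. {\<gamma> ! s, \<gamma> ! Suc s} \<in> bonds)}"

text \<open>A walk of length \<open>k + 1\<close> is a walk of length \<open>k\<close> with a point
  prepended at one of the four neighbours of its head; the starting point contributes the factor
  \<open>(N + 1)\<^sup>2\<close>.\<close>

lemma finite_card_walks: "finite (walks N k) \<and> card (walks N k) \<le> (N + 1)\<^sup>2 * 4 ^ k"
proof (induction k)
  case 0
  have "walks N 0 = (\<lambda>i. [i]) ` ({0..int N} \<times> {0..int N})"
    by (auto simp: walks_def contained_in_square_def length_Suc_conv)
  moreover have "card ((\<lambda>i. [i]) ` ({0..int N} \<times> {0..int N})) = (N + 1)\<^sup>2"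
    by (subst card_image) (auto simp: inj_on_def power2_eq_square nat_add_distrib)
  ultimately show ?case by simp
next
  case (Suc k)
  let ?D = "{(1, 0), (-1, 0), (0, 1), (0, -1)} :: point set"
  let ?f = "\<lambda>(\<gamma>, d). (hd \<gamma> + d) # \<gamma>"
  have sub: "walks N (Suc k) \<subseteq> ?f ` (walks N k \<times> ?D)"
  proof
    fix \<gamma>' assume w: "\<gamma>' \<in> walks N (Suc k)"
    then obtain i \<gamma> where \<gamma>': "\<gamma>' = i # \<gamma>" and len: "length \<gamma> = Suc k"
      by (auto simp: walks_def length_Suc_conv)
    have step: "{\<gamma>' ! s, \<gamma>' ! Suc s} \<in> bonds" if "s < Suc k" for s
      using w that by (simp add: walks_def)
    have "{\<gamma> ! s, \<gamma> ! Suc s} \<in> bonds" if "s < k" for s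
      using step[of "Suc s"] that by (simp add: \<gamma>')
    then have "\<gamma> \<in> walks N k"
      using w by (simp add: walks_def \<gamma>' contained_in_square_def)
    moreover have "{i, hd \<gamma>} \<in> bonds"
      using step[of 0] len by (cases \<gamma>) (simp_all add: \<gamma>')
    then have "i - hd \<gamma> \<in> ?D"
      by (simp only: insert_commute[of i] bonds_iff norm_pt_diff_eq_1)
    ultimately show "\<gamma>' \<in> ?f ` (walks N k \<times> ?D)"
      unfolding \<gamma>' by (intro image_eqI[where x = "(\<gamma>, i - hd \<gamma>)"]) auto
  qed
  have fin: "finite (walks N k \<times> ?D)" using Suc.IH by simp
  have "card (walks N (Suc k)) \<le> card (walks N k \<times> ?D)"
    using sub fin by (meson card_image_le card_mono finite_imageI order_trans)
  also have "\<dots> = card (walks N k) * 4" by (simp add: card_cartesian_product)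
  also have "\<dots> \<le> (N + 1)\<^sup>2 * 4 ^ Suc k" using Suc.IH by simp
  finally show ?case using sub fin finite_subset by blast
qed

section \<open>The union bound over lengths, walks and antiferromagnetic steps\<close>

definition crossed :: "point list \<Rightarrow> nat \<Rightarrow> bond" where
  "crossed \<gamma> s = dual_bond (\<gamma> ! s) (\<gamma> ! Suc s)"

lemma crossed_in_square_bonds:
  assumes "\<gamma> \<in> walks N k" "s < k"
  shows "crossed \<gamma> s \<in> square_bonds N"
  using assms unfolding crossed_def
  by (intro dual_bond_in_square_bonds) (auto simp: walks_def contained_in_square_def subset_eq)

text \<open>Equal dual bonds come from equal steps up to orientation, hence from equal segments,
  which a path does not repeat.\<close>

lemma inj_on_crossed:
  assumes "lattice_path \<gamma>"
  shows "inj_on (crossed \<gamma>) {..<path_length \<gamma>}"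
proof (rule inj_onI)
  fix s t assume st: "s \<in> {..<path_length \<gamma>}" "t \<in> {..<path_length \<gamma>}" "crossed \<gamma> s = crossed \<gamma> t"
  then have "{\<gamma> ! s, \<gamma> ! Suc s} = {\<gamma> ! t, \<gamma> ! Suc t}"
    using assms by (intro dual_bond_inj) (auto simp: lattice_path_def crossed_def)
  then have "closed_segment (pt (\<gamma> ! s)) (pt (\<gamma> ! Suc s)) =
      closed_segment (pt (\<gamma> ! t)) (pt (\<gamma> ! Suc t))"
    by (auto simp: doubleton_eq_iff closed_segment_commute)
  then show "s = t" using assms st unfolding lattice_path_def by blast
qed

lemma square_bonds_subset_bonds: "square_bonds N \<subseteq> bonds"
  by (auto simp: square_bonds_def edge_in_bonds)

text \<open>\<open>A\<close> is the set of antiferromagnetic steps of a separating path. Of the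
  distinctness of segments only the injectivity of \<open>crossed \<gamma>\<close> is kept: it
  bounds the length and later turns a count of steps into a count of bonds.\<close>

lemma B_set_subset:
  "B_set lam p N \<subseteq>
     (\<Union>k\<in>{nat \<lceil>lam * real N\<rceil>..2 * (N + 1)\<^sup>2}.
      \<Union>\<gamma>\<in>{\<gamma>\<in>walks N k. inj_on (crossed \<gamma>) {..<k}}.
      \<Union>A\<in>{A. A \<subseteq> {..<k} \<and> k \<le> 2 * card A}.
        {c \<in> C_set p N. \<forall>b\<in>crossed \<gamma> ` A. c b = -1})"
proof
  fix c assume c: "c \<in> B_set lam p N"
  then obtain \<gamma> where \<gamma>: "separating c \<gamma>" "real (path_length \<gamma>) \<ge> lam * real N"
    "contained_in_square N \<gamma>" and cC: "c \<in> C_set p N"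
    by (auto simp: B_set_def)
  define k where "k = path_length \<gamma>"
  define A where "A = {s. s < k \<and> c (crossed \<gamma> s) = -1}"
  have lp: "lattice_path \<gamma>" using \<gamma> by (simp add: separating_def)
  have w: "\<gamma> \<in> walks N k"
    using lp \<gamma>(3) by (auto simp: walks_def lattice_path_def k_def path_length_def)
  have inj: "inj_on (crossed \<gamma>) {..<k}" using inj_on_crossed[OF lp] by (simp add: k_def)
  \<comment> \<open>Distinct steps cross distinct bonds of the square, so the length is at most the
    number of these bonds and the range of \<open>k\<close> is finite.\<close>
  have "k \<le> card (square_bonds N)"
    using card_inj_on_le[OF inj _ finite_square_bonds] crossed_in_square_bonds[OF w] by auto
  then have "k \<in> {nat \<lceil>lam * real N\<rceil>..2 * (N + 1)\<^sup>2}"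
    using card_square_bonds_le[of N] \<gamma>(2) by (auto simp: k_def nat_le_iff ceiling_le_iff)
  moreover have "A \<subseteq> {..<k}" by (auto simp: A_def)
  moreover have "k \<le> 2 * card A"
    using \<gamma>(1) by (simp add: separating_def \<mu>_def A_def k_def crossed_def)
  moreover have "\<forall>b\<in>crossed \<gamma> ` A. c b = -1" by (auto simp: A_def)
  ultimately show "c \<in> (\<Union>k\<in>{nat \<lceil>lam * real N\<rceil>..2 * (N + 1)\<^sup>2}.
      \<Union>\<gamma>\<in>{\<gamma>\<in>walks N k. inj_on (crossed \<gamma>) {..<k}}.
      \<Union>A\<in>{A. A \<subseteq> {..<k} \<and> k \<le> 2 * card A}.
        {c \<in> C_set p N. \<forall>b\<in>crossed \<gamma> ` A. c b = -1})"
    using w inj cC by blast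
qed

text \<open>At least half of the steps are in \<open>A\<close> and at most four crossed bonds share
  a wrapped bond, so at least \<open>k / 8\<close> cell bonds are forced. Writing the density as
  \<open>q ^ 8\<close> turns this into the integral power \<open>q ^ k\<close>.\<close>

lemma card_crossed_fixed_le:
  assumes "N > 0" "0 \<le> q" "q \<le> 1" "\<gamma> \<in> walks N k" "inj_on (crossed \<gamma>) {..<k}"
    and "A \<subseteq> {..<k}" "k \<le> 2 * card A"
  shows "real (card {c \<in> C_set (q ^ 8) N. \<forall>b\<in>crossed \<gamma> ` A. c b = -1})
           \<le> q ^ k * real (card (C_set (q ^ 8) N))"
proof -
  let ?T = "crossed \<gamma> ` A"
  have T: "?T \<subseteq> square_bonds N" using assms(4,6) crossed_in_square_bonds by blast
  have fin: "finite ?T" using assms(6) finite_subset by blast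
  have "card ?T = card A"
    using assms(5,6) by (intro card_image) (rule inj_on_subset)
  then have k: "k \<le> 8 * card (wrap N ` ?T)"
    using card_le_card_wrap[OF assms(1) T] assms(7) by linarith
  have "real (card {c \<in> C_set (q ^ 8) N. \<forall>b\<in>?T. c b = -1})
      \<le> (q ^ 8) ^ card (wrap N ` ?T) * real (card (C_set (q ^ 8) N))"
    using assms T fin square_bonds_subset_bonds
    by (intro card_C_set_fixed_le) (auto simp: power_le_one)
  also have "\<dots> \<le> q ^ k * real (card (C_set (q ^ 8) N))"
    using k assms by (intro mult_right_mono) (auto simp: power_decreasing simp flip: power_mult)
  finally show ?thesis .
qed

lemma card_UN_le_bound:
  assumes "finite I" "real (card I) \<le> m" "0 \<le> B" "\<And>i. i \<in> I \<Longrightarrow> real (card (F i)) \<le> B"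
  shows "real (card (\<Union>i\<in>I. F i)) \<le> m * B"
proof -
  have "real (card (\<Union>i\<in>I. F i)) \<le> (\<Sum>i\<in>I. real (card (F i)))"
    using card_UN_le[OF assms(1), of F] by (simp flip: of_nat_sum)
  also have "\<dots> \<le> real (card I) * B" using assms(4) by (intro sum_bounded_above)
  also have "\<dots> \<le> m * B" using assms(2,3) by (intro mult_right_mono)
  finally show ?thesis .
qed

lemma finite_C_set:
  assumes "N > 0" "p \<ge> 0"
  shows "finite (C_set p N)"
  using bij_betw_finite[OF bij_betw_antiferro[OF assms]] finite_period_cell[of N] by simp

lemma card_B_set_le:
  assumes "N > 0" "0 \<le> q" "q \<le> 1 / 16"
  shows "real (card (B_set lam (q ^ 8) N))
     \<le> (2 * (real N + 1)\<^sup>2 + 1) * ((real N + 1)\<^sup>2 * (1 / 2) powr (lam * real N))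
         * real (card (C_set (q ^ 8) N))"
proof -
  let ?C = "real (card (C_set (q ^ 8) N))"
  define K where "K = {nat \<lceil>lam * real N\<rceil>..2 * (N + 1)\<^sup>2}"
  define W where "W k = {\<gamma>\<in>walks N k. inj_on (crossed \<gamma>) {..<k}}" for k
  define As where "As k = {A. A \<subseteq> {..<k} \<and> k \<le> 2 * card A}" for k :: nat
  define F where "F \<gamma> A = {c \<in> C_set (q ^ 8) N. \<forall>b\<in>crossed \<gamma> ` A. c b = -1}" for \<gamma> A
  have card_K: "real (card K) \<le> 2 * (real N + 1)\<^sup>2 + 1"
  proof -
    have "card K \<le> 2 * (N + 1)\<^sup>2 + 1" by (simp add: K_def)
    then have "real (card K) \<le> real (2 * (N + 1)\<^sup>2 + 1)" by (rule of_nat_mono)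
    then show ?thesis by (simp add: add.commute)
  qed
  have W: "finite (W k)" "real (card (W k)) \<le> (real N + 1)\<^sup>2 * 4 ^ k" for k
  proof -
    have sub: "W k \<subseteq> walks N k" by (auto simp: W_def)
    then show "finite (W k)" using finite_card_walks finite_subset by blast
    have "card (W k) \<le> (N + 1)\<^sup>2 * 4 ^ k"
      using sub finite_card_walks card_mono order_trans by meson
    then have "real (card (W k)) \<le> real ((N + 1)\<^sup>2 * 4 ^ k)" by (rule of_nat_mono)
    then show "real (card (W k)) \<le> (real N + 1)\<^sup>2 * 4 ^ k" by (simp add: add.commute)
  qed
  have As: "finite (As k)" "real (card (As k)) \<le> 2 ^ k" for k
  proof -
    have sub: "As k \<subseteq> Pow {..<k}" by (auto simp: As_def)
    then show "finite (As k)" using finite_subset by blast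
    have "card (As k) \<le> 2 ^ k" using card_mono[OF _ sub] by (simp add: card_Pow)
    then have "real (card (As k)) \<le> real (2 ^ k)" by (rule of_nat_mono)
    then show "real (card (As k)) \<le> 2 ^ k" by simp
  qed
  have decay: "(1 / 2) ^ k \<le> (1 / 2) powr (lam * real N)" if "k \<in> K" for k
  proof -
    have "lam * real N \<le> real k" using that by (simp add: K_def nat_le_iff ceiling_le_iff)
    then show ?thesis by (simp add: powr_mono' flip: powr_realpow)
  qed
  have fixed: "real (card (\<Union>\<gamma>\<in>W k. \<Union>A\<in>As k. F \<gamma> A))
      \<le> (real N + 1)\<^sup>2 * (1 / 2) powr (lam * real N) * ?C" if "k \<in> K" for k
  proof -
    \<comment> \<open>The factors are the number of walks, the number of choices of
      \<open>A\<close>, and the proportion of systems for each choice. They combine to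
      \<open>(8 * q) ^ k\<close>, and \<open>q \<le> 1 / 16\<close> gives
      \<open>8 * q \<le> 1 / 2\<close>.\<close>
    have "real (card (\<Union>\<gamma>\<in>W k. \<Union>A\<in>As k. F \<gamma> A)) \<le> (real N + 1)\<^sup>2 * 4 ^ k * (2 ^ k * (q ^ k * ?C))"
      using assms unfolding F_def
      by (intro card_UN_le_bound W As card_crossed_fixed_le) (auto simp: W_def As_def)
    also have "\<dots> = (real N + 1)\<^sup>2 * (8 * q) ^ k * ?C"
    proof -
      have "(8 :: real) ^ k = 4 ^ k * 2 ^ k" by (simp flip: power_mult_distrib)
      then show ?thesis by (simp add: power_mult_distrib)
    qed
    also have "\<dots> \<le> (real N + 1)\<^sup>2 * (1 / 2) ^ k * ?C"
      using assms by (intro mult_right_mono mult_left_mono power_mono) auto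
    also have "\<dots> \<le> (real N + 1)\<^sup>2 * (1 / 2) powr (lam * real N) * ?C"
      using decay[OF that] by (intro mult_right_mono mult_left_mono) auto
    finally show ?thesis .
  qed
  have finite_C: "finite (C_set (q ^ 8) N)" using assms by (intro finite_C_set) auto
  have "card (B_set lam (q ^ 8) N) \<le> card (\<Union>k\<in>K. \<Union>\<gamma>\<in>W k. \<Union>A\<in>As k. F \<gamma> A)"
  proof (rule card_mono)
    show "finite (\<Union>k\<in>K. \<Union>\<gamma>\<in>W k. \<Union>A\<in>As k. F \<gamma> A)"
      using finite_C by (rule finite_subset[rotated]) (auto simp: F_def)
    show "B_set lam (q ^ 8) N \<subseteq> (\<Union>k\<in>K. \<Union>\<gamma>\<in>W k. \<Union>A\<in>As k. F \<gamma> A)"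
      using B_set_subset unfolding K_def W_def As_def F_def .
  qed
  then have "real (card (B_set lam (q ^ 8) N)) \<le> real (card (\<Union>k\<in>K. \<Union>\<gamma>\<in>W k. \<Union>A\<in>As k. F \<gamma> A))"
    by simp
  also have "\<dots> \<le> (2 * (real N + 1)\<^sup>2 + 1) * ((real N + 1)\<^sup>2 * (1 / 2) powr (lam * real N) * ?C)"
    using fixed by (intro card_UN_le_bound[OF _ card_K]) (simp_all add: K_def)
  finally show ?thesis by (simp only: mult.assoc)
qed

section \<open>Choice of the threshold, and the limit\<close>

theorem proposition12:
  shows "\<exists>p0::real. p0 > 0 \<and> (\<forall>p\<in>{0<..<p0}. \<forall>lam::real. lam > 0 \<longrightarrow>
           (\<lambda>N. real (card (B_set lam p N)) / real (card (C_set p N))) \<longlonglongrightarrow> 0)"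
proof (intro exI conjI ballI allI impI)
  \<comment> \<open>The threshold is chosen so that the eighth root of \<open>p\<close> is at most
    \<open>1 / 16\<close>, as \<open>card_B_set_le\<close> requires.\<close>
  show "(1 / 16) ^ 8 > (0 :: real)" by simp
  fix p lam :: real assume p: "p \<in> {0<..<(1 / 16) ^ 8}" and lam: "lam > 0"
  define q where "q = root 8 p"
  have q8: "q ^ 8 = p" and q0: "0 \<le> q" using p by (simp_all add: q_def)
  have q: "q \<le> 1 / 16"
    \<comment> \<open>The rule compares powers with exponent \<open>Suc 7\<close>, that is
      8.\<close>
    using p q8 by (intro power_le_imp_le_base[of q 7]) auto
  let ?g = "\<lambda>N::nat. (2 * (real N + 1)\<^sup>2 + 1) * ((real N + 1)\<^sup>2 * (1 / 2) powr (lam * real N))"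
  show "(\<lambda>N. real (card (B_set lam p N)) / real (card (C_set p N))) \<longlonglongrightarrow> 0"
  proof (rule tendsto_sandwich[OF _ _ tendsto_const])
    show "\<forall>\<^sub>F N in sequentially. real (card (B_set lam p N)) / real (card (C_set p N)) \<le> ?g N"
      using eventually_gt_at_top[of 0]
    proof eventually_elim
      case (elim N)
      show ?case
        using card_B_set_le[OF elim q0 q] unfolding q8
        \<comment> \<open>If the denominator is 0, the quotient is 0 by convention and the bound is
          nonnegative.\<close>
        by (cases "card (C_set p N) = 0") (simp_all add: divide_le_eq)
    qed
    \<comment> \<open>The bound is rewritten as a polynomial times an exponential with one positive
      rate \<open>d = lam * ln 2\<close>, whose decay beats the polynomial.\<close>
    have "(1 / 2) powr (lam * x) = exp (- (lam * ln 2) * x)" for x :: real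
      by (simp add: powr_def ln_div)
    moreover have "(\<lambda>N::nat. (2 * (real N + 1)\<^sup>2 + 1) *
        ((real N + 1)\<^sup>2 * exp (- d * real N))) \<longlonglongrightarrow> 0" if "d > 0" for d :: real
      using that by real_asymp
    from this[of "lam * ln 2"] have "(\<lambda>N::nat. (2 * (real N + 1)\<^sup>2 + 1) *
        ((real N + 1)\<^sup>2 * exp (- (lam * ln 2) * real N))) \<longlonglongrightarrow> 0"
      using lam by simp
    ultimately show "?g \<longlonglongrightarrow> 0" by simp
  qed simp
qed

end
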